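(* Let $$A=\begin{bmatrix}\cos\theta_1&\cos\theta_2\\\sin\theta_1&\sin\theta_2\end{bmatrix}$$ be a real $2\times 2$ matrix with $\theta_1$ in the first quadrant and $\theta_1<\frac{\pi}{4}$ (so $0<\theta_1<\frac{\pi}{4}$), $\theta_2$ in the fourth quadrant and $|\theta_2|>\frac{\pi}{4}$ (so $-\frac{\pi}{2}<\theta_2<-\frac{\pi}{4}$), and $\theta_1-\frac{\pi}{2}\ne\theta_2$. Let $X_1,X_2,\dots$ be real $2\times 2$ matrices such that $X_1$ is an eigenvector matrix of $A$, $X_i$ is an eigenvector matrix of $X_{i-1}$ for every $i\ge 2$, and every $X_i$ is of the form $$X_i=\begin{bmatrix}\cos\alpha_i&\cos\beta_i\\\sin\alpha_i&\sin\beta_i\end{bmatrix}$$ with $\alpha_i$ in the first quadrant ($0<\alpha_i<\frac{\pi}{2}$) and $\beta_i$ in the fourth quadrant ($-\frac{\pi}{2}<\beta_i<0$). Then $$\lim_{i\to\infty}X_i=\begin{bmatrix}1&0\\0&-1\end{bmatrix}.$$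
   Context: An eigenvector matrix of an $n\times n$ matrix $M$ is an invertible $n\times n$ matrix $X$ whose columns are eigenvectors of $M$, each of unit Euclidean ($\mathcal L_2$) norm. *)

theory Defs
  imports "HOL-Analysis.Analysis"
begin

definition eigenvector :: "'a::field^'n^'n \<Rightarrow> 'a^'n \<Rightarrow> bool" where
  "eigenvector M v \<longleftrightarrow> v \<noteq> 0 \<and> (\<exists>k. M *v v = k *s v)"

(* The instance norm on 'a^'n is the Euclidean norm. *)
definition eigenvector_matrix :: "'a::real_normed_field^'n^'n \<Rightarrow> 'a^'n^'n \<Rightarrow> bool" where
  "eigenvector_matrix M X \<longleftrightarrow>
     invertible X \<and> (\<forall>j. eigenvector M (column j X) \<and> norm (column j X) = 1)"

(* The inner vectors are the rows: the columns are the unit vectors at angles a and b. *)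
definition angle_matrix :: "real \<Rightarrow> real \<Rightarrow> real^2^2" where
  "angle_matrix a b = vector [vector [cos a, cos b], vector [sin a, sin b]]"

end

theory Submission
  imports Defs
begin

text \<open>
  Let $M$ have columns at angles $a$ and $b$ in the first and fourth quadrant. For a unit eigenvector
  at angle $\phi$ the vectors $M v$ and $v$ are parallel, which gives
  $(\cos a - \sin b) \cos\phi \sin\phi = \sin a \cos^2\phi - \cos b \sin^2\phi$. Dropping the term of
  favourable sign yields $(\cos a - \sin b) \sin\alpha \le \sin a$ for the eigenvector in the first
  quadrant, and $(\cos a - \sin b) \cos\beta \le \cos b$ for the one in the fourth. As long as
  $\sin a$ and $\cos b$ are at most $1/\sqrt 2$, the factor $\cos a - \sin b$ is at least $\sqrt 2$,
  so both quantities decay geometrically and the bound $1/\sqrt 2$ is preserved.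
\<close>

lemma angle_matrix_nth [simp]:
  "angle_matrix a b $ 1 $ 1 = cos a" "angle_matrix a b $ 1 $ 2 = cos b"
  "angle_matrix a b $ 2 $ 1 = sin a" "angle_matrix a b $ 2 $ 2 = sin b"
  by (simp_all add: angle_matrix_def)

lemma eigenvector_angle_matrix:
  assumes "eigenvector (angle_matrix a b) v"
  shows "(cos a - sin b) * (v $ 1 * v $ 2) = sin a * (v $ 1)\<^sup>2 - cos b * (v $ 2)\<^sup>2"
proof -
  obtain k where k: "angle_matrix a b *v v = k *s v"
    using assms by (auto simp: eigenvector_def)
  have "cos a * v $ 1 + cos b * v $ 2 = k * v $ 1"
    using arg_cong[OF k, of "\<lambda>w. w $ 1"] by (simp add: matrix_vector_mult_def sum_2)
  moreover have "sin a * v $ 1 + sin b * v $ 2 = k * v $ 2"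
    using arg_cong[OF k, of "\<lambda>w. w $ 2"] by (simp add: matrix_vector_mult_def sum_2)
  \<comment> \<open>Multiplying the first equation by \<open>v $ 2\<close> and the second by
    \<open>v $ 1\<close> makes the right-hand sides equal, so k cancels.\<close>
  ultimately show ?thesis
    by algebra
qed

lemma ge_inverse_sqrt_2:
  fixes s c :: real
  assumes "0 \<le> s" "s \<le> 1 / sqrt 2" "0 \<le> c" "s\<^sup>2 + c\<^sup>2 = 1"
  shows "1 / sqrt 2 \<le> c"
proof (rule power2_le_imp_le)
  have "s\<^sup>2 \<le> (1 / sqrt 2)\<^sup>2"
    using assms by (intro power_mono)
  then show "(1 / sqrt 2)\<^sup>2 \<le> c\<^sup>2"
    using assms by (simp add: power_divide)
qed (use assms in simp)

text \<open>The conclusions again imply the bounds in \<open>small\<close>, now for \<alpha> and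
  \<beta>, so the step can be iterated.\<close>

lemma eigenvector_matrix_contraction:
  assumes a: "0 < a" "a < pi / 2" and b: "- (pi / 2) < b" "b < 0"
    and \<alpha>: "0 < \<alpha>" "\<alpha> < pi / 2" and \<beta>: "- (pi / 2) < \<beta>" "\<beta> < 0"
    and small: "sin a \<le> 1 / sqrt 2" "cos b \<le> 1 / sqrt 2"
    and ev: "eigenvector_matrix (angle_matrix a b) (angle_matrix \<alpha> \<beta>)"
  shows "sin \<alpha> \<le> sin a / sqrt 2" and "cos \<beta> \<le> cos b / sqrt 2"
proof -
  have pos: "0 < sin a" "0 < cos a" "0 < cos b" "0 < - sin b"
    "0 < sin \<alpha>" "0 < cos \<alpha>" "0 < cos \<beta>" "0 < - sin \<beta>"
    using a b \<alpha> \<beta> sin_gt_zero2[of "- b"] sin_gt_zero2[of "- \<beta>"]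
    by (auto intro!: sin_gt_zero2 cos_gt_zero_pi)
  have "1 / sqrt 2 \<le> cos a" "1 / sqrt 2 \<le> - sin b"
    using ge_inverse_sqrt_2[of "sin a" "cos a"] ge_inverse_sqrt_2[of "cos b" "- sin b"] small pos
    by auto
  moreover have "1 / sqrt 2 + 1 / sqrt 2 = sqrt (2::real)"
    by (simp add: field_simps)
  \<comment> \<open>Despite the label, this is the difference of the diagonal entries. Both summands
    \<open>cos a\<close> and \<open>- sin b\<close> are positive.\<close>
  ultimately have trace: "sqrt 2 \<le> cos a - sin b"
    by linarith
  have column: "eigenvector (angle_matrix a b) (column j (angle_matrix \<alpha> \<beta>))" for j
    using ev by (simp add: eigenvector_matrix_def)
  \<comment> \<open>The dropped term is \<open>cos b * (sin \<alpha>)\<^sup>2\<close>; the common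
    factor \<open>cos \<alpha>\<close> is then cancelled.\<close>
  have "(cos a - sin b) * sin \<alpha> * cos \<alpha> \<le> sin a * cos \<alpha> * cos \<alpha>"
    using eigenvector_angle_matrix[OF column[of 1]] pos
    by (simp add: column_def power2_eq_square mult_ac)
  then have "(cos a - sin b) * sin \<alpha> \<le> sin a * cos \<alpha>"
    using pos by simp
  also have "\<dots> \<le> sin a"
    using pos by simp
  finally have "sqrt 2 * sin \<alpha> \<le> sin a"
    using mult_right_mono[OF trace, of "sin \<alpha>"] pos by linarith
  then show "sin \<alpha> \<le> sin a / sqrt 2"
    by (simp add: field_simps)
  \<comment> \<open>For the second column the identity is negated, so that this is the term to drop
    and \<open>- sin \<beta>\<close> is the positive factor to cancel.\<close>
  have "0 \<le> sin a * (cos \<beta>)\<^sup>2"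
    using pos by simp
  then have "(cos a - sin b) * cos \<beta> * (- sin \<beta>) \<le> cos b * (- sin \<beta>) * (- sin \<beta>)"
    using eigenvector_angle_matrix[OF column[of 2]]
    by (simp add: column_def power2_eq_square mult_ac)
  then have "(cos a - sin b) * cos \<beta> \<le> cos b * (- sin \<beta>)"
    using pos by (simp only: mult_le_cancel_right_pos)
  also have "\<dots> \<le> cos b * 1"
    using pos sin_ge_minus_one[of \<beta>] by (intro mult_left_mono) auto
  finally have "sqrt 2 * cos \<beta> \<le> cos b"
    using mult_right_mono[OF trace, of "cos \<beta>"] pos by linarith
  then show "cos \<beta> \<le> cos b / sqrt 2"
    by (simp add: field_simps)
qed

text \<open>The quadrants fix the signs of \<open>cos (\<alpha> n)\<close> and
  \<open>sin (\<beta> n)\<close>, which makes them continuous functions of the two entries that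
  vanish in the limit.\<close>

lemma angle_matrix_tendsto:
  assumes quadrants: "\<And>n. 0 < \<alpha> n \<and> \<alpha> n < pi / 2 \<and> - (pi / 2) < \<beta> n \<and> \<beta> n < 0"
    and sin: "(\<lambda>n. sin (\<alpha> n)) \<longlonglongrightarrow> 0" and cos: "(\<lambda>n. cos (\<beta> n)) \<longlonglongrightarrow> 0"
  shows "(\<lambda>n. angle_matrix (\<alpha> n) (\<beta> n)) \<longlonglongrightarrow> vector [vector [1, 0], vector [0, -1]]"
proof -
  have eq: "cos (\<alpha> n) = sqrt (1 - (sin (\<alpha> n))\<^sup>2)" "sin (\<beta> n) = - sqrt (1 - (cos (\<beta> n))\<^sup>2)" for n
  proof -
    have "0 < cos (\<alpha> n)" "0 < sin (- \<beta> n)"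
      using quadrants[of n] by (auto intro!: cos_gt_zero_pi sin_gt_zero2 simp del: sin_minus)
    then show "cos (\<alpha> n) = sqrt (1 - (sin (\<alpha> n))\<^sup>2)" "sin (\<beta> n) = - sqrt (1 - (cos (\<beta> n))\<^sup>2)"
      by (simp_all flip: cos_squared_eq sin_squared_eq)
  qed
  have "(\<lambda>n. cos (\<alpha> n)) \<longlonglongrightarrow> sqrt (1 - 0\<^sup>2)"
    unfolding eq by (intro tendsto_intros sin)
  moreover have "(\<lambda>n. sin (\<beta> n)) \<longlonglongrightarrow> - sqrt (1 - 0\<^sup>2)"
    unfolding eq by (intro tendsto_intros cos)
  ultimately have "(\<lambda>n. angle_matrix (\<alpha> n) (\<beta> n) $ i $ j)
      \<longlonglongrightarrow> (vector [vector [1, 0], vector [0, -1]] :: real^2^2) $ i $ j" for i j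
    using sin cos exhaust_2[of i] exhaust_2[of j] by auto
  then show ?thesis
    by (intro vec_tendstoI)
qed

theorem theorem3p4:
  fixes \<theta>1 \<theta>2 :: real and A :: "real^2^2" and X :: "nat \<Rightarrow> real^2^2"
  assumes "A = angle_matrix \<theta>1 \<theta>2"
    and "0 < \<theta>1" and "\<theta>1 < pi / 4"
    and "- (pi / 2) < \<theta>2" and "\<theta>2 < - (pi / 4)"
    and "\<theta>1 - pi / 2 \<noteq> \<theta>2"
    and "eigenvector_matrix A (X 1)"
    and "\<And>i. i \<ge> 2 \<Longrightarrow> eigenvector_matrix (X (i - 1)) (X i)"
    and "\<And>i. i \<ge> 1 \<Longrightarrow> \<exists>\<alpha> \<beta>. 0 < \<alpha> \<and> \<alpha> < pi / 2 \<and> - (pi / 2) < \<beta> \<and> \<beta> < 0 \<and>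
           X i = angle_matrix \<alpha> \<beta>"
  shows "X \<longlonglongrightarrow> vector [vector [1, 0], vector [0, -1]]"
proof -
  \<comment> \<open>The index is shifted because nothing is assumed about \<open>X 0\<close>; the
    shift is undone at the end.\<close>
  obtain \<alpha> \<beta> where quadrants: "\<And>n. 0 < \<alpha> n \<and> \<alpha> n < pi / 2 \<and> - (pi / 2) < \<beta> n \<and> \<beta> n < 0"
    and X: "\<And>n. X (Suc n) = angle_matrix (\<alpha> n) (\<beta> n)"
  proof -
    have "\<forall>n. \<exists>\<alpha> \<beta>. (0 < \<alpha> \<and> \<alpha> < pi / 2 \<and> - (pi / 2) < \<beta> \<and> \<beta> < 0) \<and>
        X (Suc n) = angle_matrix \<alpha> \<beta>"
      using assms(9) by (metis One_nat_def Suc_le_mono le0)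
    then show thesis
      using that by metis
  qed
  \<comment> \<open>The bounds by \<open>pi / 4\<close> provide the initial smallness; evenness of
    cos moves \<theta>2 to the range where cos decreases.\<close>
  have "sin \<theta>1 \<le> sin (pi / 4)"
    using assms by (intro sin_monotone_2pi_le) auto
  moreover have "cos (- \<theta>2) \<le> cos (pi / 4)"
    using assms by (intro cos_monotone_0_pi_le) auto
  moreover have "sqrt 2 / 2 = 1 / sqrt (2::real)"
    by (simp add: field_simps)
  ultimately have small: "sin \<theta>1 \<le> 1 / sqrt 2" "cos \<theta>2 \<le> 1 / sqrt 2"
    by (simp_all add: sin_45 cos_45)
  \<comment> \<open>\<open>X (Suc n)\<close> lies \<open>Suc n\<close> contractions after A. An
    exponent of at least 1 also lets the induction hypothesis return the bound
    \<open>1 / sqrt 2\<close> that the next contraction requires.\<close>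
  have decay: "sin (\<alpha> n) \<le> (1 / sqrt 2) ^ Suc n \<and> cos (\<beta> n) \<le> (1 / sqrt 2) ^ Suc n" for n
  proof (induction n)
    case 0
    have "sin (\<alpha> 0) \<le> sin \<theta>1 / sqrt 2" "cos (\<beta> 0) \<le> cos \<theta>2 / sqrt 2"
      using eigenvector_matrix_contraction[of \<theta>1 \<theta>2 "\<alpha> 0" "\<beta> 0"]
        assms(1-5,7) small quadrants[of 0] X[of 0] by auto
    moreover have "sin \<theta>1 / sqrt 2 \<le> 1 / sqrt 2" "cos \<theta>2 / sqrt 2 \<le> 1 / sqrt 2"
      by (simp_all add: divide_right_mono)
    ultimately show ?case
      by simp
  next
    case (Suc n)
    have "(1 / sqrt 2) ^ Suc n \<le> (1 / sqrt (2::real)) ^ 1"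
      by (intro power_decreasing) auto
    then have "sin (\<alpha> n) \<le> 1 / sqrt 2" "cos (\<beta> n) \<le> 1 / sqrt 2"
      using Suc by auto
    moreover have "eigenvector_matrix (angle_matrix (\<alpha> n) (\<beta> n)) (angle_matrix (\<alpha> (Suc n)) (\<beta> (Suc n)))"
      using assms(8)[of "Suc (Suc n)"] by (simp add: X)
    ultimately have "sin (\<alpha> (Suc n)) \<le> sin (\<alpha> n) / sqrt 2" "cos (\<beta> (Suc n)) \<le> cos (\<beta> n) / sqrt 2"
      using eigenvector_matrix_contraction[of "\<alpha> n" "\<beta> n" "\<alpha> (Suc n)" "\<beta> (Suc n)"]
        quadrants[of n] quadrants[of "Suc n"] by auto
    moreover have "sin (\<alpha> n) / sqrt 2 \<le> (1 / sqrt 2) ^ Suc n / sqrt 2"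
      "cos (\<beta> n) / sqrt 2 \<le> (1 / sqrt 2) ^ Suc n / sqrt 2"
      using Suc by (intro divide_right_mono; simp)+
    moreover have "(1 / sqrt 2) ^ Suc n / sqrt 2 = (1 / sqrt (2::real)) ^ Suc (Suc n)"
      by simp
    ultimately show ?case
      by (metis order_trans)
  qed
  have "0 \<le> sin (\<alpha> n)" "0 \<le> cos (\<beta> n)" for n
    using quadrants[of n] by (auto intro!: less_imp_le sin_gt_zero2 cos_gt_zero_pi)
  moreover have geometric: "(\<lambda>n. (1 / sqrt (2::real)) ^ Suc n) \<longlonglongrightarrow> 0"
    by (intro LIMSEQ_Suc LIMSEQ_realpow_zero) auto
  ultimately have "(\<lambda>n. sin (\<alpha> n)) \<longlonglongrightarrow> 0" "(\<lambda>n. cos (\<beta> n)) \<longlonglongrightarrow> 0"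
    using decay by (auto intro!: tendsto_sandwich[OF _ _ tendsto_const geometric] always_eventually)
  then have "(\<lambda>n. X (Suc n)) \<longlonglongrightarrow> vector [vector [1, 0], vector [0, -1]]"
    unfolding X by (intro angle_matrix_tendsto quadrants)
  then show ?thesis
    by (rule LIMSEQ_imp_Suc)
qed

end
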